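(* Let $\mathcal{R}$ be a unital ring, let $n\geq 2$, let $M_n(\mathcal{R})$ be the ring of all $n\times n$ matrices over $\mathcal{R}$ with identity matrix $\mathbf{1}$, and let $\mathcal{M}$ be a $2$-torsion free unital $M_n(\mathcal{R})$-bimodule. Let $D:M_n(\mathcal{R})\rightarrow\mathcal{M}$ be an additive map such that for all $\mathbf{a},\mathbf{b}\in M_n(\mathcal{R})$, $$\mathbf{a}\mathbf{b}=\mathbf{b}\mathbf{a}=0\ \Longrightarrow\ D(\mathbf{a})\mathbf{b}+\mathbf{a}D(\mathbf{b})+D(\mathbf{b})\mathbf{a}+\mathbf{b}D(\mathbf{a})-\mathbf{a}D(\mathbf{1})\mathbf{b}-\mathbf{b}D(\mathbf{1})\mathbf{a}=0.$$ Then there exists a derivation $\delta:M_n(\mathcal{R})\rightarrow\mathcal{M}$ such that $D(\mathbf{a})=\delta(\mathbf{a})+\mathbf{a}D(\mathbf{1})$ for each $\mathbf{a}\in M_n(\mathcal{R})$.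
   Context: All rings are associative (not necessarily commutative). An $\mathcal{A}$-bimodule $\mathcal{M}$ over a unital ring $\mathcal{A}$ is unital if $1m=m=m1$ for all $m\in\mathcal{M}$, and is $2$-torsion free if $2m=0$ implies $m=0$ for $m\in\mathcal{M}$. An additive map $\delta:\mathcal{A}\rightarrow\mathcal{M}$ is a derivation if $\delta(ab)=\delta(a)b+a\delta(b)$ for all $a,b\in\mathcal{A}$. *)

theory Defs
  imports "HOL-Analysis.Analysis"
begin

text \<open>
  Unital rings are not assumed nontrivial, so the entries have sort \<open>{ring, monoid_mult}\<close>
  (that is, \<open>ring_1\<close> without \<open>0 \<noteq> 1\<close>). The product \<open>(**)\<close> is restricted to
  \<open>semiring_1\<close>; on that sort it coincides with the product below. The operation \<open>(*)\<close>
  on vectors cannot be used, since it multiplies componentwise.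
\<close>

definition mat_mul :: "'r::ring ^ 'n ^ 'n \<Rightarrow> 'r ^ 'n ^ 'n \<Rightarrow> 'r ^ 'n ^ 'n"
    (infixl \<open>\<odot>\<close> 70)
  where "A \<odot> B = (\<chi> i j. \<Sum>k\<in>UNIV. A $ i $ k * B $ k $ j)"

lemma mat_mul_eq_matrix_matrix_mult:
  fixes A B :: "'r::ring_1 ^ 'n ^ 'n"
  shows "A \<odot> B = A ** B"
  by (simp add: mat_mul_def matrix_matrix_mult_def)

text \<open>
  Square matrices are not an instance of a ring class for \<open>\<odot>\<close>, so the multiplication and
  the identity of a unital ring on an additive group are explicit parameters.
\<close>

locale unital_ring =
  fixes mul :: "'a::ab_group_add \<Rightarrow> 'a \<Rightarrow> 'a" and one :: 'a
  assumes mult_assoc: "mul (mul a b) c = mul a (mul b c)"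
    and mult_add_left: "mul (a + b) c = mul a c + mul b c"
    and mult_add_right: "mul a (b + c) = mul a b + mul a c"
    and mult_one_left: "mul one a = a"
    and mult_one_right: "mul a one = a"

lemma unital_ring_mat:
  "unital_ring ((\<odot>) :: 'r::{ring, monoid_mult} ^ 'n ^ 'n \<Rightarrow> _) (mat 1)"
proof
  fix A B C :: "'r ^ 'n ^ 'n"
  show "A \<odot> B \<odot> C = A \<odot> (B \<odot> C)"
    unfolding mat_mul_def vec_eq_iff
    by (simp add: sum_distrib_left sum_distrib_right mult.assoc) (intro allI, rule sum.swap)
  show "(A + B) \<odot> C = A \<odot> C + B \<odot> C"
    by (simp add: mat_mul_def vec_eq_iff distrib_right sum.distrib)
  show "A \<odot> (B + C) = A \<odot> B + A \<odot> C"
    by (simp add: mat_mul_def vec_eq_iff distrib_left sum.distrib)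
  show "mat 1 \<odot> A = A"
    by (simp add: mat_mul_def mat_def vec_eq_iff if_distrib if_distribR sum.delta' cong: if_cong)
  show "A \<odot> mat 1 = A"
    by (simp add: mat_mul_def mat_def vec_eq_iff if_distrib if_distribR sum.delta cong: if_cong)
qed

locale unital_bimodule = unital_ring mul one
  for mul :: "'a::ab_group_add \<Rightarrow> 'a \<Rightarrow> 'a" and one :: 'a +
  fixes lact :: "'a \<Rightarrow> 'm::ab_group_add \<Rightarrow> 'm" and ract :: "'m \<Rightarrow> 'a \<Rightarrow> 'm"
  assumes lact_add_ring: "lact (a + b) m = lact a m + lact b m"
    and lact_add_module: "lact a (m + m') = lact a m + lact a m'"
    and ract_add_ring: "ract m (a + b) = ract m a + ract m b"
    and ract_add_module: "ract (m + m') a = ract m a + ract m' a"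
    and lact_mult: "lact (mul a b) m = lact a (lact b m)"
    and ract_mult: "ract m (mul a b) = ract (ract m a) b"
    and lact_ract: "ract (lact a m) b = lact a (ract m b)"
    and lact_one: "lact one m = m"
    and ract_one: "ract m one = m"

definition derivation ::
    "('a::ab_group_add \<Rightarrow> 'a \<Rightarrow> 'a) \<Rightarrow> ('a \<Rightarrow> 'm::ab_group_add \<Rightarrow> 'm) \<Rightarrow> ('m \<Rightarrow> 'a \<Rightarrow> 'm)
      \<Rightarrow> ('a \<Rightarrow> 'm) \<Rightarrow> bool"
  where "derivation mul lact ract \<delta> \<longleftrightarrow>
    Modules.additive \<delta> \<and> (\<forall>a b. \<delta> (mul a b) = ract (\<delta> a) b + lact a (\<delta> b))"

end

theory Submission
  imports Defs
begin

text \<open>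
  Put \<open>T a = D a - a D(1)\<close>. Then \<open>T 1 = 0\<close>, and the correction terms with \<open>D(1)\<close> in the hypothesis
  cancel: \<open>T a b + a T b + T b a + b T a = 0\<close> whenever \<open>ab = ba = 0\<close>. It has to be shown that such
  a \<open>T\<close> is a derivation. Write \<open>A\<close> for the matrix ring and \<open>M\<close> for the bimodule.

  The pair \<open>(p, 1 - p)\<close> for an idempotent \<open>p\<close> gives \<open>T p = p T p + T p p\<close>, the Leibniz rule at
  \<open>(p, p)\<close>. Let \<open>e\<close> be the matrix unit at one diagonal position and \<open>f = 1 - e\<close>. Since \<open>T e\<close> has
  only off-diagonal Peirce components, it is the value at \<open>e\<close> of an inner derivation, and
  subtracting that derivation one may assume \<open>T e = T f = 0\<close>. Now \<open>T\<close> is compared with the Peirce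
  decomposition of the ring with respect to \<open>e\<close> and \<open>f\<close>:

  \<^item> \<open>T\<close> maps \<open>eAe\<close> into \<open>eMe\<close>, because every element of \<open>eAe\<close> annihilates \<open>f\<close> (\<open>diagonal\<close>).

  \<^item> For \<open>b\<close> in \<open>eAf\<close>, both \<open>e + b\<close> and \<open>e - b\<close> are idempotent, whence \<open>T b\<close> lies in \<open>eMf + fMe\<close> and
    \<open>T b b + b T b = 0\<close> (\<open>off_diagonal\<close>).

  \<^item> The annihilating pairs \<open>a(e + b), f - b\<close> and \<open>(f - b)d, e + b\<close> give the Leibniz rule for \<open>ab\<close> and \<open>bd\<close>,
    where \<open>a \<in> eAe\<close> and \<open>d \<in> fAf\<close>, up to a term from the \<open>fMe\<close> component of \<open>T b\<close>.

  \<^item> That component \<open>q(b)\<close> is the trace of a possible anti-derivation. It satisfies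
    \<open>q(ab) = q(b)a\<close> and \<open>q(b)b = 0\<close>. The matrix units \<open>u\<close> in \<open>eAf\<close> and \<open>v\<close> in \<open>fAe\<close> with \<open>uvu = u\<close> give
    \<open>q(u) = q(u)uv = 0\<close>, and every \<open>b\<close> is a sum of products \<open>(bv)u\<close>, so \<open>q = 0\<close>
    (\<open>no_transposed_part\<close>). With a single row there would be no such \<open>u\<close> and \<open>v\<close>.

  \<^item> For \<open>a, a'\<close> in \<open>eAe\<close>, expanding \<open>T (aa'b)\<close> in two ways shows that the defect
    \<open>T (aa') - T a a' - a T a'\<close> kills \<open>eAf\<close> from the left, hence it kills \<open>e\<close> and vanishes.

  \<^item> For \<open>b\<close> in \<open>eAf\<close> and \<open>c\<close> in \<open>fAe\<close> the annihilating pair \<open>(e + c)(e + b), (f - b)(f - c)\<close> gives the Leibniz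
    rule for \<open>bc\<close> (\<open>leibniz_off_diagonal\<close>).

  The remaining products of Peirce components follow by exchanging \<open>e\<close> and \<open>f\<close>, or are zero
  for trivial reasons, and additivity finishes the proof.
\<close>

section \<open>Arithmetic in rings and bimodules\<close>

context unital_ring
begin

sublocale left_mult: Modules.additive "\<lambda>b. mul a b" for a
  by standard (rule mult_add_right)

sublocale right_mult: Modules.additive "\<lambda>a. mul a b" for b
  by standard (rule mult_add_left)

lemmas mult_distribs = mult_add_left mult_add_right left_mult.diff right_mult.diff
  left_mult.minus right_mult.minus left_mult.zero right_mult.zero

lemma mult_assoc_eq: "mul a b = c \<Longrightarrow> mul a (mul b x) = mul c x"
  by (simp flip: mult_assoc)

text \<open>
  For orthogonal idempotents \<open>g\<close> and \<open>h\<close> these elements lie in the ideal \<open>hAgAh\<close> of the corner \<open>hAh\<close>, and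
  \<open>h\<close> being among them is a strong form of fullness of \<open>g\<close>, which matrix units provide. The
  regularity \<open>uvu = u\<close> makes it possible to compute \<open>T u\<close> from \<open>T ((uv)u)\<close>.
\<close>

inductive_set regular_sums :: "'a \<Rightarrow> 'a \<Rightarrow> 'a set" for g h where
  zero: "0 \<in> regular_sums g h"
| add: "x \<in> regular_sums g h \<Longrightarrow> y \<in> regular_sums g h \<Longrightarrow> x + y \<in> regular_sums g h"
| prod: "mul g u = u \<Longrightarrow> mul u h = u \<Longrightarrow> mul h v = v \<Longrightarrow> mul v g = v
    \<Longrightarrow> mul u (mul v u) = u \<Longrightarrow> mul v u \<in> regular_sums g h"

lemma regular_sums_sum:
  assumes "\<And>i. i \<in> I \<Longrightarrow> x i \<in> regular_sums g h"
  shows "sum x I \<in> regular_sums g h"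
  using assms by (induction I rule: infinite_finite_induct) (auto intro: regular_sums.intros)

end

context unital_bimodule
begin

sublocale lact_hom: Modules.additive "\<lambda>m. lact a m" for a
  by standard (rule lact_add_module)

sublocale lact_ring_hom: Modules.additive "\<lambda>a. lact a m" for m
  by standard (rule lact_add_ring)

sublocale ract_hom: Modules.additive "\<lambda>m. ract m a" for a
  by standard (rule ract_add_module)

sublocale ract_ring_hom: Modules.additive "\<lambda>a. ract m a" for m
  by standard (rule ract_add_ring)

lemmas act_distribs = lact_add_ring lact_add_module ract_add_ring ract_add_module
  lact_hom.diff lact_ring_hom.diff ract_hom.diff ract_ring_hom.diff
  lact_hom.minus lact_ring_hom.minus ract_hom.minus ract_ring_hom.minus
  lact_hom.zero lact_ring_hom.zero ract_hom.zero ract_ring_hom.zero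

lemmas act_assoc = lact_mult[symmetric] ract_mult[symmetric] lact_ract

lemma derivation_inner: "derivation mul lact ract (\<lambda>a. ract x a - lact a x)"
  unfolding derivation_def Modules.additive_def
  by (simp add: act_distribs act_assoc)

lemma derivation_add:
  assumes "derivation mul lact ract \<delta>" "derivation mul lact ract \<delta>'"
  shows "derivation mul lact ract (\<lambda>a. \<delta> a + \<delta>' a)"
  using assms unfolding derivation_def Modules.additive_def
  by (simp add: act_distribs)

end

section \<open>Maps that are derivable at annihilating pairs\<close>

locale zero_product_derivation =
  unital_bimodule mul one lact ract
  for mul :: "'a::ab_group_add \<Rightarrow> 'a \<Rightarrow> 'a" (infixl \<open>\<cdot>\<close> 75) and one :: 'a (\<open>\<one>\<close>)
    and lact :: "'a \<Rightarrow> 'm::ab_group_add \<Rightarrow> 'm" (infixr \<open>\<rhd>\<close> 71)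
    and ract :: "'m \<Rightarrow> 'a \<Rightarrow> 'm" (infixl \<open>\<lhd>\<close> 72) +
  fixes T :: "'a \<Rightarrow> 'm"
  assumes two_torsion_free: "(m :: 'm) + m = 0 \<Longrightarrow> m = 0"
    and additive: "Modules.additive T"
    and one: "T \<one> = 0"
    and zero_product: "a \<cdot> b = 0 \<Longrightarrow> b \<cdot> a = 0 \<Longrightarrow>
      T a \<lhd> b + a \<rhd> T b + T b \<lhd> a + b \<rhd> T a = 0"
begin

sublocale T: Modules.additive T
  by (rule additive)

lemmas T_distribs = T.add T.diff T.minus T.zero

lemma two_torsion_free': "m + m = m' + m' \<Longrightarrow> m = m'" for m m' :: 'm
  using two_torsion_free[of "m - m'"] by (simp add: algebra_simps)

lemma eq_minus_self: "m = - m \<Longrightarrow> m = 0" for m :: 'm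
  using two_torsion_free[of m] by (metis add.right_inverse)

text \<open>
  Because \<open>T 1 = 0\<close>, the condition at the annihilating pair \<open>(p, 1 - p)\<close> is twice the claimed equation.
\<close>

lemma idempotent:
  assumes "p \<cdot> p = p"
  shows "T p = p \<rhd> T p + T p \<lhd> p"
proof -
  have "p \<cdot> (\<one> - p) = 0" "(\<one> - p) \<cdot> p = 0"
    by (simp_all add: mult_distribs mult_one_left mult_one_right assms)
  from zero_product[OF this]
  show ?thesis
    by - (rule two_torsion_free', simp add: T_distribs act_distribs one lact_one ract_one algebra_simps)
qed

end

section \<open>Action on Peirce components\<close>

text \<open>
  The assumption \<open>T e = 0\<close> is no loss of generality, as it can be reached by subtracting an inner derivation.
  The two fullness conditions keep the locale symmetric in \<open>e\<close> and \<open>f\<close>, so each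
  statement below also holds with the two idempotents exchanged.
\<close>

locale peirce_derivation = zero_product_derivation +
  fixes e f :: 'a
  assumes ee: "e \<cdot> e = e" and ff: "f \<cdot> f = f" and ef: "e \<cdot> f = 0" and fe: "f \<cdot> e = 0"
    and sum_ef: "e + f = \<one>"
    and Te: "T e = 0"
    and full_f: "f \<in> regular_sums e f" and full_e: "e \<in> regular_sums f e"
begin

lemma Tf: "T f = 0"
  using T.add[of e f] by (simp add: sum_ef one Te)

lemma swapped: "peirce_derivation mul one lact ract T f e"
  by unfold_locales
    (rule ee ff ef fe sum_ef[unfolded add.commute[of e]] Tf full_f full_e)+

lemma act_split: "e \<rhd> m + f \<rhd> m = m" "m \<lhd> e + m \<lhd> f = m"
  by (simp_all add: sum_ef lact_one ract_one flip: lact_add_ring ract_add_ring)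

lemma lact_e_iff: "e \<rhd> m = m \<longleftrightarrow> f \<rhd> m = 0"
  using act_split(1)[of m] by (metis add.right_neutral add_left_cancel)

lemma ract_e_iff: "m \<lhd> e = m \<longleftrightarrow> m \<lhd> f = 0"
  using act_split(2)[of m] by (metis add.right_neutral add_left_cancel)

lemma annihilations:
  shows mult_left_zero: "e \<cdot> x = x \<Longrightarrow> f \<cdot> x = 0"
    and mult_right_zero: "x \<cdot> e = x \<Longrightarrow> x \<cdot> f = 0"
    and mult_mid_zero: "x \<cdot> e = x \<Longrightarrow> f \<cdot> y = y \<Longrightarrow> x \<cdot> y = 0"
    and lact_mid_zero: "x \<cdot> e = x \<Longrightarrow> f \<rhd> m = m \<Longrightarrow> x \<rhd> m = 0"
    and ract_mid_zero: "m \<lhd> e = m \<Longrightarrow> f \<cdot> x = x \<Longrightarrow> m \<lhd> x = 0"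
  by (metis ef fe mult_assoc right_mult.zero left_mult.zero lact_mult ract_mult
      lact_ring_hom.zero ract_ring_hom.zero)+

text \<open>
  Both products of \<open>a\<close> and \<open>f\<close> vanish and \<open>T f = 0\<close>, so \<open>T a f + f T a = 0\<close>.
  Compressing to \<open>fMf\<close> first, with torsion-freeness, and then to the off-diagonal
  corners kills all components except that in \<open>eMe\<close>.
\<close>

lemma diagonal:
  assumes "e \<cdot> a = a" "a \<cdot> e = a"
  shows "e \<rhd> T a = T a" "T a \<lhd> e = T a"
proof -
  have af: "a \<cdot> f = 0" and fa: "f \<cdot> a = 0"
    using assms by (auto intro: annihilations)
  have *: "T a \<lhd> f + f \<rhd> T a = 0"
    using zero_product[OF af fa] by (simp add: Tf act_distribs)
  \<comment> \<open>Both summands have the same \<open>fMf\<close> component, so it is zero by torsion-freeness.\<close>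
  have "f \<rhd> (T a \<lhd> f + f \<rhd> T a) \<lhd> f = 0"
    by (simp add: * act_distribs)
  then have ftf: "f \<rhd> (T a \<lhd> f) = 0"
    by - (rule two_torsion_free, simp add: act_distribs act_assoc ff)
  have "f \<rhd> (T a \<lhd> f + f \<rhd> T a) = 0" "(T a \<lhd> f + f \<rhd> T a) \<lhd> f = 0"
    by (simp_all add: * act_distribs)
  then show "e \<rhd> T a = T a" "T a \<lhd> e = T a"
    by (simp_all add: lact_e_iff ract_e_iff act_distribs act_assoc ff ftf)
qed

text \<open>
  The elements \<open>e + b\<close> and \<open>e - b\<close> are both idempotent. In the resulting two equations for \<open>T b\<close> the terms
  linear in \<open>b\<close> agree and the quadratic ones have opposite signs, so they separate.
\<close>

lemma off_diagonal:
  assumes "e \<cdot> b = b" "b \<cdot> f = b"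
  shows "T b = e \<rhd> T b + T b \<lhd> e" "T b \<lhd> b + b \<rhd> T b = 0"
proof -
  interpret swap: peirce_derivation mul one lact ract T f e
    by (rule swapped)
  have be: "b \<cdot> e = 0" and bb: "b \<cdot> b = 0"
    using assms by (auto intro: annihilations swap.annihilations)
  have "T (e + b) = (e + b) \<rhd> T (e + b) + T (e + b) \<lhd> (e + b)"
    by (rule idempotent) (simp add: mult_distribs ee assms be bb)
  then have plus: "T b = (e \<rhd> T b + T b \<lhd> e) + (T b \<lhd> b + b \<rhd> T b)"
    by (simp add: T_distribs Te act_distribs algebra_simps)
  have "T (e - b) = (e - b) \<rhd> T (e - b) + T (e - b) \<lhd> (e - b)"
    by (rule idempotent) (simp add: mult_distribs ee assms be bb)
  then have minus: "T b = (e \<rhd> T b + T b \<lhd> e) - (T b \<lhd> b + b \<rhd> T b)"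
    by (simp add: T_distribs Te act_distribs algebra_simps)
  have "T b \<lhd> b + b \<rhd> T b = - (T b \<lhd> b + b \<rhd> T b)"
    using plus minus by (metis add_left_cancel diff_conv_add_uminus)
  then show *: "T b \<lhd> b + b \<rhd> T b = 0"
    by (rule eq_minus_self)
  show "T b = e \<rhd> T b + T b \<lhd> e"
    using plus unfolding * by simp
qed

text \<open>
  As \<open>f = 1 - e\<close>, this is the first part of \<open>off_diagonal\<close> subtracted from \<open>2 T b\<close>.
\<close>

lemma off_diagonal_f:
  assumes "e \<cdot> b = b" "b \<cdot> f = b"
  shows "T b = f \<rhd> T b + T b \<lhd> f"
proof -
  have "(e \<rhd> T b + f \<rhd> T b) + (T b \<lhd> e + T b \<lhd> f) = T b + T b"
    by (simp only: act_split)
  with off_diagonal(1)[OF assms] show ?thesis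
    by (metis (no_types, lifting) add.assoc add.commute add_left_cancel)
qed

text \<open>
  Since \<open>(e + b)(f - b) = 0\<close> and \<open>(f - b)a = 0\<close>, the elements \<open>a(e + b) = a + ab\<close> and \<open>f - b\<close> annihilate each other. Their
  condition has terms of first and of second degree in \<open>b\<close>, the one of degree zero being
  \<open>T a f + f T a = 0\<close>; replacing \<open>b\<close> by \<open>-b\<close> separates them, and
  the part of first degree is the claim.
\<close>

lemma product_diagonal_off_diagonal:
  assumes a: "e \<cdot> a = a" "a \<cdot> e = a" and b: "e \<cdot> b = b" "b \<cdot> f = b"
  shows "T (a \<cdot> b) = T a \<lhd> b + a \<rhd> T b + T b \<lhd> a"
proof -
  interpret swap: peirce_derivation mul one lact ract T f e
    by (rule swapped)
  have z: "f \<cdot> a = 0" "f \<cdot> b = 0" "b \<cdot> a = 0" "b \<cdot> b = 0" "a \<cdot> f = 0"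
    "T a \<lhd> f = 0" "f \<rhd> T a = 0" "b \<rhd> T a = 0"
    using a b diagonal[OF a] by (auto intro: annihilations swap.annihilations simp: lact_e_iff ract_e_iff)
  have ab: "e \<cdot> (a \<cdot> b) = a \<cdot> b" "a \<cdot> b \<cdot> f = a \<cdot> b"
    using a b by (simp_all add: mult_assoc) (simp add: mult_assoc_eq)
  have *: "T (a \<cdot> y) \<lhd> f + f \<rhd> T (a \<cdot> y) - T a \<lhd> y - a \<rhd> T y - T y \<lhd> a
     = T (a \<cdot> y) \<lhd> y + y \<rhd> T (a \<cdot> y) + (a \<cdot> y) \<rhd> T y + T y \<lhd> (a \<cdot> y)"
    if "y = b \<or> y = - b" for y
  proof -
    have zz: "(a + a \<cdot> y) \<cdot> (f - y) = 0" "(f - y) \<cdot> (a + a \<cdot> y) = 0"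
      using that b by (auto simp: mult_distribs mult_assoc z mult_assoc_eq[OF z(1)] mult_assoc_eq[OF z(2)] mult_assoc_eq[OF z(3)])
    have "y \<rhd> T a = 0" using that z by (auto simp: act_distribs)
    then show ?thesis
      using zero_product[OF zz] by (simp add: T_distribs Tf act_distribs z algebra_simps)
  qed
  have "- (T (a \<cdot> b) \<lhd> f + f \<rhd> T (a \<cdot> b) - T a \<lhd> b - a \<rhd> T b - T b \<lhd> a)
      = T (a \<cdot> b) \<lhd> b + b \<rhd> T (a \<cdot> b) + (a \<cdot> b) \<rhd> T b + T b \<lhd> (a \<cdot> b)"
    using *[of "- b"] by (simp add: T_distribs act_distribs mult_distribs algebra_simps)
  with *[of b] have "T (a \<cdot> b) \<lhd> f + f \<rhd> T (a \<cdot> b) - T a \<lhd> b - a \<rhd> T b - T b \<lhd> a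
      = - (T (a \<cdot> b) \<lhd> f + f \<rhd> T (a \<cdot> b) - T a \<lhd> b - a \<rhd> T b - T b \<lhd> a)"
    by simp
  then have "T (a \<cdot> b) \<lhd> f + f \<rhd> T (a \<cdot> b) - T a \<lhd> b - a \<rhd> T b - T b \<lhd> a = 0"
    by (rule eq_minus_self)
  then show ?thesis
    using off_diagonal_f[OF ab] by (simp add: algebra_simps)
qed

text \<open>
  The mirror image of the previous lemma, with the annihilating pair \<open>(f - b)d = d - bd\<close> and \<open>e + b\<close>.
\<close>

lemma product_off_diagonal_diagonal:
  assumes b: "e \<cdot> b = b" "b \<cdot> f = b" and d: "f \<cdot> d = d" "d \<cdot> f = d"
  shows "T (b \<cdot> d) = T b \<lhd> d + b \<rhd> T d + d \<rhd> T b"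
proof -
  interpret swap: peirce_derivation mul one lact ract T f e
    by (rule swapped)
  have z: "d \<cdot> e = 0" "e \<cdot> d = 0" "b \<cdot> e = 0" "d \<cdot> b = 0" "b \<cdot> b = 0"
    "T d \<lhd> e = 0" "e \<rhd> T d = 0" "T d \<lhd> b = 0"
    using b d swap.diagonal[OF d] by (auto intro: annihilations swap.annihilations simp: swap.lact_e_iff swap.ract_e_iff)
  have bd: "e \<cdot> (b \<cdot> d) = b \<cdot> d" "b \<cdot> d \<cdot> f = b \<cdot> d"
    using b d by (simp_all add: mult_assoc) (simp add: mult_assoc_eq)
  have *: "T (y \<cdot> d) \<lhd> e + e \<rhd> T (y \<cdot> d) - T y \<lhd> d - y \<rhd> T d - d \<rhd> T y
     = - (T (y \<cdot> d) \<lhd> y + y \<rhd> T (y \<cdot> d) + (y \<cdot> d) \<rhd> T y + T y \<lhd> (y \<cdot> d))"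
    if "y = b \<or> y = - b" for y
  proof -
    have zz: "(d - y \<cdot> d) \<cdot> (e + y) = 0" "(e + y) \<cdot> (d - y \<cdot> d) = 0"
      using that b by (auto simp: mult_distribs mult_assoc z mult_assoc_eq[OF b(1)] mult_assoc_eq[OF z(5)])
    have "T d \<lhd> y = 0" using that z by (auto simp: act_distribs)
    then show ?thesis
      using zero_product[OF zz] by (simp add: T_distribs Te act_distribs z algebra_simps)
  qed
  have "- (T (b \<cdot> d) \<lhd> e + e \<rhd> T (b \<cdot> d) - T b \<lhd> d - b \<rhd> T d - d \<rhd> T b)
      = - (T (b \<cdot> d) \<lhd> b + b \<rhd> T (b \<cdot> d) + (b \<cdot> d) \<rhd> T b + T b \<lhd> (b \<cdot> d))"
    using *[of "- b"] by (simp add: T_distribs act_distribs mult_distribs algebra_simps)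
  with *[of b] have "T (b \<cdot> d) \<lhd> e + e \<rhd> T (b \<cdot> d) - T b \<lhd> d - b \<rhd> T d - d \<rhd> T b
      = - (T (b \<cdot> d) \<lhd> e + e \<rhd> T (b \<cdot> d) - T b \<lhd> d - b \<rhd> T d - d \<rhd> T b)"
    by simp
  then have "T (b \<cdot> d) \<lhd> e + e \<rhd> T (b \<cdot> d) - T b \<lhd> d - b \<rhd> T d - d \<rhd> T b = 0"
    by (rule eq_minus_self)
  then show ?thesis
    using off_diagonal(1)[OF bd] by (simp add: algebra_simps)
qed

text \<open>
  By the previous lemmas, \<open>q(b) = f T b\<close> satisfies \<open>q(ab) = q(b)a\<close> for \<open>a \<in> eAe\<close>, and \<open>q(u)u = 0\<close>
  is the \<open>fMf\<close> component of \<open>T u u + u T u = 0\<close>. If \<open>uvu = u\<close>, then \<open>q(u) = q((uv)u) = q(u)uv = 0\<close>, so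
  \<open>q(bvu) = q(u)bv = 0\<close> for each \<open>b\<close>. Summing over products \<open>vu\<close> with sum \<open>f\<close> gives \<open>q(b) = 0\<close>.
\<close>

lemma no_transposed_part:
  assumes b: "e \<cdot> b = b" "b \<cdot> f = b"
  shows "f \<rhd> T b = 0"
proof -
  have f_left: "f \<rhd> T (a \<cdot> y) = f \<rhd> T y \<lhd> a"
    if "e \<cdot> a = a" "a \<cdot> e = a" "e \<cdot> y = y" "y \<cdot> f = y" for a y
  proof -
    have "f \<cdot> a = 0" "f \<rhd> T a = 0"
      using that diagonal[of a] by (auto intro: annihilations simp: lact_e_iff)
    then show ?thesis
      by (simp add: product_diagonal_off_diagonal that act_distribs flip: lact_mult lact_ract)
  qed
  have "f \<rhd> T (b \<cdot> x) = 0" if "x \<in> regular_sums e f" for x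
    using that
  proof induction
    case (prod u v)
    have "u \<cdot> v \<cdot> u = u" "e \<cdot> (u \<cdot> v) = u \<cdot> v" "u \<cdot> v \<cdot> e = u \<cdot> v"
      using prod by (simp_all add: mult_assoc) (simp add: mult_assoc_eq)
    then have "f \<rhd> T u = f \<rhd> T u \<lhd> (u \<cdot> v)"
      using f_left[of "u \<cdot> v" u] prod by simp
    also have "\<dots> = f \<rhd> (T u \<lhd> u + u \<rhd> T u) \<lhd> v"
      using mult_left_zero[OF prod(1)] by (simp add: act_distribs act_assoc)
    also have "\<dots> = 0"
      using off_diagonal(2)[OF prod(1,2)] by (simp add: act_distribs)
    finally have "f \<rhd> T u = 0" .
    moreover have "e \<cdot> (b \<cdot> v) = b \<cdot> v" "b \<cdot> v \<cdot> e = b \<cdot> v"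
      using prod b by (simp_all add: mult_assoc) (simp add: mult_assoc_eq)
    ultimately show ?case
      using f_left[of "b \<cdot> v" u] prod by (simp add: act_distribs mult_assoc lact_ract[symmetric])
  qed (simp_all add: mult_distribs T_distribs act_distribs)
  from this[OF full_f] show ?thesis
    by (simp add: b)
qed

lemma off_diagonal_corner:
  assumes b: "e \<cdot> b = b" "b \<cdot> f = b"
  shows "e \<rhd> T b = T b" "T b \<lhd> f = T b"
  using no_transposed_part[OF b] off_diagonal_f[OF b] by (simp_all add: lact_e_iff)

section \<open>The Leibniz rule on Peirce components\<close>

lemma leibniz_diagonal_off_diagonal:
  assumes a: "e \<cdot> a = a" "a \<cdot> e = a" and b: "e \<cdot> b = b" "b \<cdot> f = b"
  shows "T (a \<cdot> b) = T a \<lhd> b + a \<rhd> T b"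
proof -
  interpret swap: peirce_derivation mul one lact ract T f e
    by (rule swapped)
  show ?thesis
    using product_diagonal_off_diagonal[OF assms]
      swap.ract_mid_zero[OF off_diagonal_corner(2)[OF b] a(1)] by simp
qed

lemma leibniz_off_diagonal_diagonal:
  assumes b: "e \<cdot> b = b" "b \<cdot> f = b" and d: "f \<cdot> d = d" "d \<cdot> f = d"
  shows "T (b \<cdot> d) = T b \<lhd> d + b \<rhd> T d"
proof -
  interpret swap: peirce_derivation mul one lact ract T f e
    by (rule swapped)
  show ?thesis
    using product_off_diagonal_diagonal[OF assms]
      swap.lact_mid_zero[OF d(2) off_diagonal_corner(1)[OF b]] by simp
qed

text \<open>
  The Leibniz rule for \<open>(aa')b = a(a'b)\<close>, evaluated in both ways, shows that the defect \<open>m\<close> of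
  the pair \<open>(a, a')\<close> satisfies \<open>mb = 0\<close> for all \<open>b\<close> in \<open>eAf\<close>. As \<open>e\<close> is a sum of products that begin with such a \<open>b\<close>,
  also \<open>me = 0\<close>, and \<open>m\<close> lies in \<open>eMe\<close>.
\<close>

lemma leibniz_diagonal:
  assumes a: "e \<cdot> a = a" "a \<cdot> e = a" and a': "e \<cdot> a' = a'" "a' \<cdot> e = a'"
  shows "T (a \<cdot> a') = T a \<lhd> a' + a \<rhd> T a'"
proof -
  define m where "m = T (a \<cdot> a') - T a \<lhd> a' - a \<rhd> T a'"
  have aa': "e \<cdot> (a \<cdot> a') = a \<cdot> a'" "a \<cdot> a' \<cdot> e = a \<cdot> a'"
    using a a' by (simp_all add: mult_assoc) (simp add: mult_assoc_eq)
  have kill: "m \<lhd> b = 0" if b: "e \<cdot> b = b" "b \<cdot> f = b" for b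
  proof -
    have ab: "e \<cdot> (a' \<cdot> b) = a' \<cdot> b" "a' \<cdot> b \<cdot> f = a' \<cdot> b"
      using a' b by (simp_all add: mult_assoc) (simp add: mult_assoc_eq)
    show ?thesis
      using leibniz_diagonal_off_diagonal[OF aa' b] leibniz_diagonal_off_diagonal[OF a ab]
        leibniz_diagonal_off_diagonal[OF a' b]
      by (simp add: m_def act_distribs act_assoc mult_assoc algebra_simps)
  qed
  \<comment> \<open>The generators \<open>vu\<close> start with \<open>v \<in> eAf\<close>, which \<open>m\<close> annihilates.\<close>
  have "m \<lhd> x = 0" if "x \<in> regular_sums f e" for x
    using that by induction (simp_all add: act_distribs ract_mult kill)
  from this[OF full_e] have "m \<lhd> e = 0" .
  moreover have "m \<lhd> e = m"
    by (simp add: m_def act_distribs act_assoc a' aa' diagonal[OF aa'] diagonal[OF a'])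
  ultimately show ?thesis
    by (simp add: m_def algebra_simps)
qed

text \<open>
  From \<open>(e + b)(f - b) = 0\<close> and \<open>(f - c)(e + c) = 0\<close> the elements \<open>x = (e + c)(e + b)\<close> and
  \<open>y = (f - b)(f - c)\<close> annihilate each other. As \<open>y\<close> contains the term \<open>bc\<close>, the \<open>eMe\<close> component of their
  condition is twice the Leibniz rule for \<open>bc\<close>.
\<close>

lemma leibniz_off_diagonal:
  assumes b: "e \<cdot> b = b" "b \<cdot> f = b" and c: "f \<cdot> c = c" "c \<cdot> e = c"
  shows "T (b \<cdot> c) = T b \<lhd> c + b \<rhd> T c"
proof -
  interpret swap: peirce_derivation mul one lact ract T f e
    by (rule swapped)
  note assoc_eqs = b[THEN mult_assoc_eq] c[THEN mult_assoc_eq]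
  have z: "f \<cdot> b = 0" "b \<cdot> e = 0" "e \<cdot> c = 0" "c \<cdot> f = 0" "b \<cdot> b = 0" "c \<cdot> c = 0"
    using b c by (auto intro: annihilations swap.annihilations)
  have bc: "e \<cdot> (b \<cdot> c) = b \<cdot> c" "b \<cdot> c \<cdot> e = b \<cdot> c"
    and cb: "f \<cdot> (c \<cdot> b) = c \<cdot> b" "c \<cdot> b \<cdot> f = c \<cdot> b"
    using b c by (simp_all add: mult_assoc) (simp_all add: mult_assoc_eq)
  note corner = off_diagonal_corner[OF b] swap.off_diagonal_corner[OF c]
    diagonal[OF bc] swap.diagonal[OF cb]
  have corner_zero: "T b \<lhd> e = 0" "e \<rhd> T c = 0" "e \<rhd> T (c \<cdot> b) = 0" "T (c \<cdot> b) \<lhd> e = 0"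
    using corner by (simp_all add: swap.lact_e_iff swap.ract_e_iff)
  have product_zero: "T b \<lhd> b \<cdot> c = 0" "b \<rhd> T (b \<cdot> c) = 0" "T (b \<cdot> c) \<lhd> c = 0" "b \<cdot> c \<rhd> T c = 0"
    using b c bc corner by (auto intro: ract_mid_zero lact_mid_zero swap.ract_mid_zero swap.lact_mid_zero)
  define x where "x = e + b + c + c \<cdot> b"
  define y where "y = f - b - c + b \<cdot> c"
  have x: "x = (e + c) \<cdot> (e + b)" and y: "y = (f - b) \<cdot> (f - c)"
    by (simp_all add: x_def y_def mult_distribs ee ff b c z algebra_simps)
  \<comment> \<open>The inner factors cancel in both products.\<close>
  have ebfb: "(e + b) \<cdot> (f - b) = 0" and fcec: "(f - c) \<cdot> (e + c) = 0"
    by (simp_all add: mult_distribs ef fe b c z)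
  have xy: "x \<cdot> y = 0" "y \<cdot> x = 0"
  proof -
    have "x \<cdot> y = (e + c) \<cdot> ((e + b) \<cdot> (f - b)) \<cdot> (f - c)"
      "y \<cdot> x = (f - b) \<cdot> ((f - c) \<cdot> (e + c)) \<cdot> (e + b)"
      by (simp_all only: x y mult_assoc)
    then show "x \<cdot> y = 0" "y \<cdot> x = 0"
      by (simp_all add: ebfb fcec left_mult.zero right_mult.zero)
  qed
  have Tx: "T x = T b + T c + T (c \<cdot> b)" and Ty: "T y = T (b \<cdot> c) - T b - T c"
    by (simp_all add: x_def y_def T_distribs Te Tf)
  have ex: "e \<cdot> x = e + b" "x \<cdot> e = e + c" and ey: "e \<cdot> y = b \<cdot> c - b" "y \<cdot> e = b \<cdot> c - c"
    by (simp_all add: x_def y_def mult_distribs ee ef fe b c z bc mult_assoc assoc_eqs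
       mult_assoc_eq[OF z(3)])
  have eT: "e \<rhd> T x = T b" "T x \<lhd> e = T c" "e \<rhd> T y = T (b \<cdot> c) - T b" "T y \<lhd> e = T (b \<cdot> c) - T c"
    by (simp_all add: Tx Ty act_distribs corner corner_zero)
  have "e \<rhd> (T x \<lhd> y + x \<rhd> T y + T y \<lhd> x + y \<rhd> T x) \<lhd> e = 0"
    using zero_product[OF xy] by (simp add: act_distribs)
  also have "e \<rhd> (T x \<lhd> y + x \<rhd> T y + T y \<lhd> x + y \<rhd> T x) \<lhd> e
      = (e \<rhd> T x) \<lhd> (y \<cdot> e) + (e \<cdot> x) \<rhd> (T y \<lhd> e) + (e \<rhd> T y) \<lhd> (x \<cdot> e) + (e \<cdot> y) \<rhd> (T x \<lhd> e)"
    by (simp add: act_distribs act_assoc)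
  also have "\<dots> = (T (b \<cdot> c) + T (b \<cdot> c)) - ((T b \<lhd> c + b \<rhd> T c) + (T b \<lhd> c + b \<rhd> T c))"
    by (simp add: eT ex ey act_distribs corner corner_zero product_zero algebra_simps)
  finally show ?thesis
    by - (rule two_torsion_free', simp)
qed

lemma peirce_sum: "e \<cdot> a \<cdot> e + e \<cdot> a \<cdot> f + f \<cdot> a \<cdot> e + f \<cdot> a \<cdot> f = a"
proof -
  have "(e + f) \<cdot> a \<cdot> (e + f) = a"
    by (simp add: sum_ef mult_one_left mult_one_right)
  then show ?thesis
    by (simp add: mult_distribs algebra_simps)
qed

lemma corner_preserved:
  assumes "g \<in> {e, f}" "h \<in> {e, f}" "g \<cdot> a = a" "a \<cdot> h = a"
  shows "g \<rhd> T a = T a" "T a \<lhd> h = T a"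
proof -
  interpret swap: peirce_derivation mul one lact ract T f e
    by (rule swapped)
  show "g \<rhd> T a = T a" "T a \<lhd> h = T a"
    using assms diagonal[of a] swap.diagonal[of a] off_diagonal_corner[of a]
      swap.off_diagonal_corner[of a] by auto
qed

lemma leibniz_corners:
  assumes "g \<in> {e, f}" "h \<in> {e, f}" "h' \<in> {e, f}" "k \<in> {e, f}"
    and a: "g \<cdot> a = a" "a \<cdot> h = a" and b: "h' \<cdot> b = b" "b \<cdot> k = b"
  shows "T (a \<cdot> b) = T a \<lhd> b + a \<rhd> T b"
proof -
  interpret swap: peirce_derivation mul one lact ract T f e
    by (rule swapped)
  show ?thesis
  proof (cases "h = h'")
    case True
    with assms show ?thesis
      by (auto intro: leibniz_diagonal leibniz_diagonal_off_diagonal leibniz_off_diagonal_diagonal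
          leibniz_off_diagonal swap.leibniz_diagonal swap.leibniz_diagonal_off_diagonal
          swap.leibniz_off_diagonal_diagonal swap.leibniz_off_diagonal)
  next
    case False
    with assms(2,3) have "h = e \<and> h' = f \<or> h = f \<and> h' = e" by auto
    then have "a \<cdot> b = 0 \<and> T a \<lhd> b = 0 \<and> a \<rhd> T b = 0"
      using a(2) b(1) corner_preserved(2)[OF assms(1,2) a] corner_preserved(1)[OF assms(3,4) b]
        mult_mid_zero[of a b] lact_mid_zero[of a "T b"] ract_mid_zero[of "T a" b]
        swap.mult_mid_zero[of a b] swap.lact_mid_zero[of a "T b"] swap.ract_mid_zero[of "T a" b]
      by blast
    then show ?thesis
      by (simp add: T_distribs)
  qed
qed

theorem derivation: "derivation mul lact ract T"
proof -
  have "T (a \<cdot> b) = T a \<lhd> b + a \<rhd> T b" for a b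
  proof -
    have corner: "g \<cdot> (g \<cdot> x \<cdot> h) = g \<cdot> x \<cdot> h" "g \<cdot> x \<cdot> h \<cdot> h = g \<cdot> x \<cdot> h"
      if "g \<in> {e, f}" "h \<in> {e, f}" for g h x
      using that by (auto simp: mult_assoc ee ff mult_assoc_eq[OF ee] mult_assoc_eq[OF ff])
    have left: "T (g \<cdot> a \<cdot> h \<cdot> b) = T (g \<cdot> a \<cdot> h) \<lhd> b + (g \<cdot> a \<cdot> h) \<rhd> T b"
      if "g \<in> {e, f}" "h \<in> {e, f}" for g h
    proof -
      have "T (g \<cdot> a \<cdot> h \<cdot> (g' \<cdot> b \<cdot> h'))
          = T (g \<cdot> a \<cdot> h) \<lhd> (g' \<cdot> b \<cdot> h') + (g \<cdot> a \<cdot> h) \<rhd> T (g' \<cdot> b \<cdot> h')"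
        if "g' \<in> {e, f}" "h' \<in> {e, f}" for g' h'
        using \<open>g \<in> {e, f}\<close> \<open>h \<in> {e, f}\<close> that by (auto intro!: leibniz_corners[of g h g' h'] corner)
      then have "T (g \<cdot> a \<cdot> h \<cdot> (e \<cdot> b \<cdot> e + e \<cdot> b \<cdot> f + f \<cdot> b \<cdot> e + f \<cdot> b \<cdot> f))
          = T (g \<cdot> a \<cdot> h) \<lhd> (e \<cdot> b \<cdot> e + e \<cdot> b \<cdot> f + f \<cdot> b \<cdot> e + f \<cdot> b \<cdot> f)
            + (g \<cdot> a \<cdot> h) \<rhd> T (e \<cdot> b \<cdot> e + e \<cdot> b \<cdot> f + f \<cdot> b \<cdot> e + f \<cdot> b \<cdot> f)"
        by (simp add: mult_add_right lact_add_module ract_add_ring T.add)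
      then show ?thesis
        by (simp only: peirce_sum)
    qed
    then have "T ((e \<cdot> a \<cdot> e + e \<cdot> a \<cdot> f + f \<cdot> a \<cdot> e + f \<cdot> a \<cdot> f) \<cdot> b)
        = T (e \<cdot> a \<cdot> e + e \<cdot> a \<cdot> f + f \<cdot> a \<cdot> e + f \<cdot> a \<cdot> f) \<lhd> b
          + (e \<cdot> a \<cdot> e + e \<cdot> a \<cdot> f + f \<cdot> a \<cdot> e + f \<cdot> a \<cdot> f) \<rhd> T b"
      by (simp add: mult_add_left lact_add_ring ract_add_module T.add)
    then show ?thesis
      by (simp only: peirce_sum)
  qed
  then show ?thesis
    by (simp add: derivation_def additive)
qed

end

section \<open>Removing the normalisations\<close>

text \<open>
  Here \<open>x = T e e - e T e\<close> is chosen so that its inner derivation agrees with \<open>T\<close> at \<open>e\<close>: from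
  \<open>T e = e T e + T e e\<close> it follows that \<open>e T e e = 0\<close>, hence \<open>xe - ex = T e e + e T e\<close>. The difference
  still satisfies the condition on annihilating pairs, because derivations do.
\<close>

theorem (in zero_product_derivation) derivation_of_full_idempotents:
  assumes "e \<cdot> e = e" "f \<cdot> f = f" "e \<cdot> f = 0" "f \<cdot> e = 0" "e + f = \<one>"
    and "f \<in> regular_sums e f" "e \<in> regular_sums f e"
  shows "derivation mul lact ract T"
proof -
  define x where "x = T e \<lhd> e - e \<rhd> T e"
  define I where "I a = x \<lhd> a - a \<rhd> x" for a
  have I: "derivation mul lact ract I"
    unfolding I_def by (rule derivation_inner)
  interpret I: Modules.additive I
    using I by (simp add: derivation_def)
  have I_mult: "I (a \<cdot> b) = I a \<lhd> b + a \<rhd> I b" for a b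
    using I by (simp add: derivation_def)
  have Te: "T e = e \<rhd> T e + T e \<lhd> e"
    by (rule idempotent) fact
  then have "e \<rhd> T e = e \<rhd> (e \<rhd> T e + T e \<lhd> e)"
    by simp
  then have eTe: "e \<rhd> T e \<lhd> e = 0"
    by (simp add: act_distribs act_assoc assms)
  have "I e = T e"
    using Te eTe by (simp add: I_def x_def act_distribs act_assoc assms add.commute)
  have S: "zero_product_derivation mul \<one> lact ract (\<lambda>a. T a - I a)"
  proof unfold_locales
    show "T \<one> - I \<one> = 0"
      by (simp add: one I_def lact_one ract_one)
    fix a b assume ab: "a \<cdot> b = 0" "b \<cdot> a = 0"
    have "I a \<lhd> b + a \<rhd> I b + (I b \<lhd> a + b \<rhd> I a) = 0"
      using I_mult[of a b] I_mult[of b a] by (simp add: ab I.zero)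
    moreover have "(T a - I a) \<lhd> b + a \<rhd> (T b - I b) + (T b - I b) \<lhd> a + b \<rhd> (T a - I a)
        = (T a \<lhd> b + a \<rhd> T b + T b \<lhd> a + b \<rhd> T a)
          - (I a \<lhd> b + a \<rhd> I b + (I b \<lhd> a + b \<rhd> I a))"
      by (simp add: act_distribs algebra_simps)
    ultimately show "(T a - I a) \<lhd> b + a \<rhd> (T b - I b) + (T b - I b) \<lhd> a + b \<rhd> (T a - I a) = 0"
      using zero_product[OF ab] by simp
  qed (rule two_torsion_free, assumption, simp add: T.add I.add)
  interpret S: peirce_derivation mul \<one> lact ract "\<lambda>a. T a - I a" e f
    using S by (rule peirce_derivation.intro) (unfold_locales; simp add: assms \<open>I e = T e\<close>)
  show ?thesis
    using derivation_add[OF S.derivation I] by simp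
qed

text \<open>
  In the condition for \<open>a \<mapsto> D a - a D(1)\<close> the correction terms are \<open>a D(1) b\<close>, \<open>ab D(1)\<close>, \<open>b D(1) a\<close> and \<open>ba D(1)\<close>; those
  with \<open>ab\<close> and \<open>ba\<close> vanish, and the other two are subtracted in the hypothesis on \<open>D\<close>.
\<close>

theorem (in unital_bimodule) derivation_plus_multiplication:
  assumes torsion: "\<And>m :: 'm. m + m = 0 \<Longrightarrow> m = 0"
    and D: "Modules.additive D"
    and zero_product: "\<And>a b. mul a b = 0 \<Longrightarrow> mul b a = 0 \<Longrightarrow>
      ract (D a) b + lact a (D b) + ract (D b) a + lact b (D a)
        - ract (lact a (D one)) b - ract (lact b (D one)) a = 0"
    and ef: "mul e e = e" "mul f f = f" "mul e f = 0" "mul f e = 0" "e + f = one"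
    and full: "f \<in> regular_sums e f" "e \<in> regular_sums f e"
  shows "derivation mul lact ract (\<lambda>a. D a - lact a (D one))"
proof -
  interpret D: Modules.additive D by fact
  interpret zero_product_derivation mul one lact ract "\<lambda>a. D a - lact a (D one)"
  proof unfold_locales
    show "D one - lact one (D one) = 0"
      by (simp add: lact_one)
    fix a b assume ab: "mul a b = 0" "mul b a = 0"
    then show "ract (D a - lact a (D one)) b + lact a (D b - lact b (D one))
        + ract (D b - lact b (D one)) a + lact b (D a - lact a (D one)) = 0"
      using zero_product[OF ab]
      by (simp add: act_distribs lact_mult[symmetric] algebra_simps)
  qed (rule torsion, assumption, simp add: D.add lact_add_ring)
  show ?thesis
    using ef full by (rule derivation_of_full_idempotents)
qed

section \<open>Matrix rings\<close>

definition unit_mat :: "'n \<Rightarrow> 'n \<Rightarrow> 'r::{ring, monoid_mult} ^ 'n ^ 'n" where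
  "unit_mat i j = (\<chi> k l. if k = i \<and> l = j then 1 else 0)"

lemma unit_mat_mult:
  "unit_mat i j \<odot> unit_mat k l = (if j = k then unit_mat i l else 0)"
proof -
  have "(\<Sum>m\<in>UNIV. (if p = i \<and> m = j then 1 else 0) * (if m = k \<and> q = l then 1 else 0))
      = (if j = k \<and> p = i \<and> q = l then 1 else (0 :: 'a))" for p q
  proof -
    have "(if p = i \<and> m = j then 1 else 0) * (if m = k \<and> q = l then 1 else (0 :: 'a))
        = (if m = j then if j = k \<and> p = i \<and> q = l then 1 else 0 else 0)" for m
      by auto
    then show ?thesis
      by simp
  qed
  then show ?thesis
    by (simp add: mat_mul_def unit_mat_def vec_eq_iff)
qed

lemma sum_unit_mat: "(\<Sum>i\<in>UNIV. unit_mat i i) = mat 1"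
proof -
  have "(\<Sum>i\<in>UNIV. if k = i \<and> l = i then 1 else (0::'a)) = (if k = l then 1 else 0)" for k l :: 'b
  proof -
    have "(if k = i \<and> l = i then 1 else (0::'a)) = (if k = i then if k = l then 1 else 0 else 0)" for i
      by auto
    then show ?thesis
      by simp
  qed
  then show ?thesis
    by (simp add: unit_mat_def mat_def vec_eq_iff)
qed

text \<open>
  For \<open>j \<noteq> i\<close> put \<open>u = E\<^sub>i\<^sub>j\<close> and \<open>v = E\<^sub>j\<^sub>i\<close>, so that \<open>vu = E\<^sub>j\<^sub>j\<close>. These products sum to \<open>f = 1 - E\<^sub>i\<^sub>i\<close>.
  Conversely \<open>E\<^sub>i\<^sub>i = E\<^sub>i\<^sub>k E\<^sub>k\<^sub>i\<close> for a single index \<open>k \<noteq> i\<close>, so both idempotents are full.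
\<close>

theorem theorem2p2:
  fixes lact :: "'r::{ring, monoid_mult} ^ 'n ^ 'n \<Rightarrow> 'm::ab_group_add \<Rightarrow> 'm"  (infixr \<open>\<rhd>\<close> 70)
    and ract :: "'m \<Rightarrow> 'r ^ 'n ^ 'n \<Rightarrow> 'm"  (infixl \<open>\<lhd>\<close> 70)
    and D :: "'r ^ 'n ^ 'n \<Rightarrow> 'm"
  assumes "CARD('n) \<ge> 2"
    and "unital_bimodule (\<odot>) (mat 1) lact ract"
    and "\<And>m :: 'm. m + m = 0 \<Longrightarrow> m = 0"
    and "Modules.additive D"
    and "\<And>a b. a \<odot> b = 0 \<Longrightarrow> b \<odot> a = 0 \<Longrightarrow>
      (D a \<lhd> b) + (a \<rhd> D b) + (D b \<lhd> a) + (b \<rhd> D a)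
        - ((a \<rhd> D (mat 1)) \<lhd> b) - ((b \<rhd> D (mat 1)) \<lhd> a) = 0"
  shows "\<exists>\<delta>. derivation (\<odot>) lact ract \<delta> \<and> (\<forall>a. D a = \<delta> a + (a \<rhd> D (mat 1)))"
proof -
  interpret unital_bimodule "(\<odot>)" "mat 1" lact ract
    by (rule assms(2))
  obtain i k :: 'n where ik: "i \<noteq> k"
    using assms(1) card_le_Suc0_iff_eq[of "UNIV :: 'n set"] by auto
  define e :: "'r ^ 'n ^ 'n" where "e = unit_mat i i"
  define f :: "'r ^ 'n ^ 'n" where "f = (\<Sum>j\<in>UNIV - {i}. unit_mat j j)"
  have sum: "e + f = mat 1"
    unfolding e_def f_def sum_unit_mat[symmetric] by (simp add: sum.remove[of UNIV i])
  have ee: "e \<odot> e = e"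
    by (simp add: e_def unit_mat_mult)
  have f: "f = mat 1 - e"
    using sum by (simp add: algebra_simps)
  have ef: "f \<odot> f = f" "e \<odot> f = 0" "f \<odot> e = 0"
    by (simp_all add: f mult_distribs ee mult_one_left mult_one_right)
  have f_unit: "f \<odot> unit_mat j l = unit_mat j l" "unit_mat l j \<odot> f = unit_mat l j"
    if "j \<noteq> i" for j l
    using that by (simp_all add: f e_def mult_distribs mult_one_left mult_one_right unit_mat_mult)
  have e_unit: "e \<odot> unit_mat i l = unit_mat i l" "unit_mat l i \<odot> e = unit_mat l i" for l
    by (simp_all add: e_def unit_mat_mult)
  have "unit_mat j i \<odot> unit_mat i j \<in> regular_sums e f" if "j \<noteq> i" for j
    using that by (intro regular_sums.prod) (simp_all add: f_unit e_unit, simp add: unit_mat_mult)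
  then have "(\<Sum>j\<in>UNIV - {i}. unit_mat j j) \<in> regular_sums e f"
    by (intro regular_sums_sum) (simp add: unit_mat_mult)
  then have full_f: "f \<in> regular_sums e f"
    by (simp only: f_def)
  have "unit_mat i k \<odot> unit_mat k i \<in> regular_sums f e"
    using ik by (intro regular_sums.prod) (simp_all add: f_unit e_unit, simp add: unit_mat_mult)
  then have full_e: "e \<in> regular_sums f e"
    by (simp add: unit_mat_mult e_def)
  have "derivation (\<odot>) lact ract (\<lambda>a. D a - (a \<rhd> D (mat 1)))"
    by (rule derivation_plus_multiplication[OF assms(3-5) ee ef sum full_f full_e])
  then show ?thesis
    by (intro exI[of _ "\<lambda>a. D a - (a \<rhd> D (mat 1))"]) simp
qed

end
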